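(* If $G$ is a connected graph of order at least $2$ and $m\ge 2$, then $\mathrm{gp}_{\rm o}(G\circ K_m)=m\cdot\mathrm{gp}_{\rm o}(G)$.
   Context: All graphs are finite and simple. For $X\subseteq V(G)$, two vertices $u,v$ are $X$-positionable if no shortest $u,v$-path has an internal vertex in $X$. $X$ is an outer general position set if every two vertices of $X$ are $X$-positionable and every $u\in X$, $v\in V(G)\setminus X$ are $X$-positionable; $\mathrm{gp}_{\rm o}$ is the maximum cardinality of such a set. The lexicographic product $G\circ H$ has vertex set $V(G)\times V(H)$, with $(g,h)$ and $(g',h')$ adjacent iff either $gg'\in E(G)$, or $g=g'$ and $hh'\in E(H)$. $K_m$ is the complete graph on $m$ vertices. *)

theory Defs
  imports "Graph_Theory.Graph_Theory"
begin

text \<open>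
  Finite simple graphs are the library's \<^locale>\<open>pair_graph\<close>: a finite vertex set together with a
  finite, symmetric, loopless set of ordered pairs, each edge being present in both directions.
  A path is a list of arcs, so \<^const>\<open>length\<close> is its number of edges.
\<close>

definition shortest_path :: "'a pair_pre_digraph \<Rightarrow> 'a \<Rightarrow> ('a \<times> 'a) awalk \<Rightarrow> 'a \<Rightarrow> bool" where
  "shortest_path G u p v \<longleftrightarrow>
     pre_digraph.apath (with_proj G) u p v \<and>
     (\<forall>q. pre_digraph.apath (with_proj G) u q v \<longrightarrow> length p \<le> length q)"

definition positionable :: "'a pair_pre_digraph \<Rightarrow> 'a set \<Rightarrow> 'a \<Rightarrow> 'a \<Rightarrow> bool" where
  "positionable G X u v \<longleftrightarrow>
     \<not> (\<exists>p. shortest_path G u p v \<and>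
            (\<exists>w \<in> set (pre_digraph.inner_verts (with_proj G) p). w \<in> X))"

definition outer_general_position_set :: "'a pair_pre_digraph \<Rightarrow> 'a set \<Rightarrow> bool" where
  "outer_general_position_set G X \<longleftrightarrow>
     X \<subseteq> pverts G \<and>
     (\<forall>u \<in> X. \<forall>v \<in> X. u \<noteq> v \<longrightarrow> positionable G X u v) \<and>
     (\<forall>u \<in> X. \<forall>v \<in> pverts G - X. positionable G X u v)"

definition gp_outer :: "'a pair_pre_digraph \<Rightarrow> nat" where
  "gp_outer G = Max (card ` {X. outer_general_position_set G X})"

definition lex_product ::
  "'a pair_pre_digraph \<Rightarrow> 'b pair_pre_digraph \<Rightarrow> ('a \<times> 'b) pair_pre_digraph" where
  "lex_product G H =
     \<lparr> pverts = pverts G \<times> pverts H,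
       parcs = {((g, h), (g', h')).
         (g, h) \<in> pverts G \<times> pverts H \<and> (g', h') \<in> pverts G \<times> pverts H \<and>
         ((g, g') \<in> parcs G \<or> g = g' \<and> (h, h') \<in> parcs H)} \<rparr>"

text \<open>
  The maximum in \<^const>\<open>gp_outer\<close> is attained on a finite graph, and lexicographic products of finite
  simple graphs are again finite simple graphs.
\<close>

lemma outer_general_position_set_empty: "outer_general_position_set G {}"
  by (simp add: outer_general_position_set_def)

lemma finite_outer_general_position_sets:
  assumes "finite (pverts G)"
  shows "finite {X. outer_general_position_set G X}"
  by (rule finite_subset[of _ "Pow (pverts G)"])
     (auto simp: outer_general_position_set_def assms)

lemma pair_graph_lex_product:
  assumes "pair_graph G" "pair_graph H"
  shows "pair_graph (lex_product G H)"
proof -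
  interpret G: pair_graph G by fact
  interpret H: pair_graph H by fact
  have sG: "(b, a) \<in> parcs G" if "(a, b) \<in> parcs G" for a b
    using G.pair_sym_arcs that by (auto simp: symmetric_def dest: symD)
  have sH: "(b, a) \<in> parcs H" if "(a, b) \<in> parcs H" for a b
    using H.pair_sym_arcs that by (auto simp: symmetric_def dest: symD)
  have fin: "finite (parcs (lex_product G H))"
    by (rule finite_subset[of _ "(pverts G \<times> pverts H) \<times> (pverts G \<times> pverts H)"])
       (auto simp: lex_product_def G.pair_finite_verts H.pair_finite_verts)
  show ?thesis
  proof unfold_locales
    show "finite (pverts (lex_product G H))"
      by (simp add: lex_product_def G.pair_finite_verts H.pair_finite_verts)
    show "finite (parcs (lex_product G H))" by (rule fin)
    show "symmetric (with_proj (lex_product G H))"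
      by (auto simp: symmetric_def lex_product_def intro!: symI dest: sG sH)
  next
    fix e assume "e \<in> parcs (lex_product G H)"
    then show "fst e \<noteq> snd e"
      by (auto simp: lex_product_def dest: G.pair_no_loops H.pair_no_loops)
  qed (auto simp: lex_product_def)
qed

end

theory Submission
  imports Defs
begin

text \<open>
  In a connected graph, \<open>X\<close> is an outer general position set iff any two distinct \<open>u, w \<in> X\<close> are
  mutually maximally distant, i.e. no neighbour of \<open>w\<close> is farther from \<open>u\<close> than \<open>w\<close> is: a farther
  neighbour would extend a shortest path from \<open>u\<close> through \<open>w\<close>, and conversely.  In \<open>G \<circ> K\<^sub>m\<close> two
  vertices of the same layer are adjacent twins, hence always mutually maximally distant, while between
  different layers all distances are those of \<open>G\<close>.  So the outer general position sets of the product
  are exactly the vertex sets whose projection to \<open>G\<close> is one, and the largest are \<open>X \<times> V(K\<^sub>m)\<close>.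
\<close>

section \<open>Distance as the least exponent of the arc relation\<close>

text \<open>Only meaningful when \<open>v\<close> is reachable from \<open>u\<close>; otherwise the value is unspecified.\<close>

definition gdist :: "'a pair_pre_digraph \<Rightarrow> 'a \<Rightarrow> 'a \<Rightarrow> nat" where
  "gdist G u v = (LEAST n. (u, v) \<in> parcs G ^^ n)"

lemma gdist_le: "(u, v) \<in> parcs G ^^ n \<Longrightarrow> gdist G u v \<le> n"
  unfolding gdist_def by (rule Least_le)

lemma relpow_gdist: "(u, v) \<in> (parcs G)\<^sup>* \<Longrightarrow> (u, v) \<in> parcs G ^^ gdist G u v"
  unfolding gdist_def by (metis LeastI rtrancl_imp_relpow)

lemma gdist_eq_0_iff: "(u, v) \<in> (parcs G)\<^sup>* \<Longrightarrow> gdist G u v = 0 \<longleftrightarrow> u = v"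
  using relpow_gdist[of u v G] gdist_le[of u v 0 G] by auto

lemma gdist_arc_le:
  assumes "(u, v) \<in> (parcs G)\<^sup>*" "(v, w) \<in> parcs G"
  shows "gdist G u w \<le> Suc (gdist G u v)"
  using relpow_gdist[OF assms(1)] assms(2) by (intro gdist_le) auto

section \<open>Walks and shortest paths in terms of distance\<close>

context pair_wf_digraph
begin

text \<open>Translates between arc lists, in which paths are defined, and relation powers, in which
  distances are. The hypothesis on \<open>u\<close> matters at length 0: the empty walk exists only
  at a vertex, whereas the zeroth power is the identity on the whole type.\<close>

lemma awalk_iff_relpow:
  assumes "u \<in> pverts G"
  shows "(\<exists>p. awalk u p v \<and> length p = n) \<longleftrightarrow> (u, v) \<in> parcs G ^^ n"
  using assms
proof (induction n arbitrary: u)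
  case 0
  then show ?case by (auto simp: awalk_Nil_iff)
next
  case (Suc n)
  have "(\<exists>p. awalk u p v \<and> length p = Suc n) \<longleftrightarrow>
      (\<exists>x. (u, x) \<in> parcs G \<and> (\<exists>p. awalk x p v \<and> length p = n))" (is "?L \<longleftrightarrow> ?R")
  proof
    assume ?L
    then obtain e p where "awalk u (e # p) v" "length p = n" by (metis length_Suc_conv)
    then have "(u, snd e) \<in> parcs G" "awalk (snd e) p v" by (auto simp: awalk_Cons_iff)
    with \<open>length p = n\<close> show ?R by blast
  next
    assume ?R
    then obtain x p where "(u, x) \<in> parcs G" "awalk x p v" "length p = n" by blast
    then have "awalk u ((u, x) # p) v \<and> length ((u, x) # p) = Suc n"
      by (simp add: awalk_Cons_iff)
    then show ?L by blast
  qed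
  also have "\<dots> \<longleftrightarrow> (\<exists>x. (u, x) \<in> parcs G \<and> (x, v) \<in> parcs G ^^ n)"
    using Suc.IH wellformed'(2) by metis
  also have "\<dots> \<longleftrightarrow> (u, v) \<in> parcs G ^^ Suc n"
    using relpow_Suc_D2 relpow_Suc_I2 by metis
  finally show ?case .
qed

lemma gdist_le_length: "awalk u p v \<Longrightarrow> gdist G u v \<le> length p"
  using awalk_iff_relpow awalk_hd_in_verts by (blast intro: gdist_le)

lemma awalk_gdist:
  assumes "u \<in> pverts G" "(u, v) \<in> (parcs G)\<^sup>*"
  obtains p where "awalk u p v" "length p = gdist G u v"
  using awalk_iff_relpow[OF assms(1)] relpow_gdist[OF assms(2)] by blast

text \<open>A repeated vertex would allow a nonempty closed walk to be cut out, leaving a walk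
  shorter than the distance.\<close>

lemma apath_if_length_gdist:
  assumes "awalk u p v" "length p = gdist G u v"
  shows "apath u p v"
proof (rule ccontr)
  assume "\<not> apath u p v"
  then have "\<not> distinct (awalk_verts u p)" using assms by (simp add: apath_def)
  then obtain q r s where "p = q @ r @ s" "r \<noteq> []" "awalk u (q @ s) v"
    using awalk_cyc_decompE'[OF assms(1)] unfolding closed_w_def
    by (metis awalk_appendI length_greater_0_conv)
  then show False using gdist_le_length[of u "q @ s" v] assms(2)
    by (auto simp flip: length_greater_0_conv simp del: awalk_append_iff)
qed

text \<open>Minimising over walks and over paths gives the same value, because a walk of minimal
  length is a path. Distinctness of vertices thus need not be checked when shortest paths are
  extended or spliced.\<close>

lemma shortest_path_iff:
  "shortest_path G u p v \<longleftrightarrow> awalk u p v \<and> length p = gdist G u v"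
proof
  assume p: "shortest_path G u p v"
  then have w: "awalk u p v" by (simp add: shortest_path_def awalkI_apath)
  then have "(u, v) \<in> (parcs G)\<^sup>*"
    using awalk_iff_relpow awalk_hd_in_verts by (blast intro: relpow_imp_rtrancl)
  then obtain q where q: "awalk u q v" "length q = gdist G u v"
    using awalk_gdist w awalk_hd_in_verts by metis
  then have "length p \<le> gdist G u v"
    using p apath_if_length_gdist by (metis shortest_path_def)
  with w show "awalk u p v \<and> length p = gdist G u v"
    using gdist_le_length by (simp add: le_antisym)
next
  assume "awalk u p v \<and> length p = gdist G u v"
  then show "shortest_path G u p v"
    by (auto simp: shortest_path_def apath_if_length_gdist intro: gdist_le_length awalkI_apath)
qed

section \<open>Outer general position as mutual maximal distance\<close>

lemma outer_general_position_set_iff: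
  assumes reach: "\<And>u v. u \<in> pverts G \<Longrightarrow> v \<in> pverts G \<Longrightarrow> (u, v) \<in> (parcs G)\<^sup>*"
  shows "outer_general_position_set G X \<longleftrightarrow>
    X \<subseteq> pverts G \<and>
    (\<forall>u \<in> X. \<forall>w \<in> X. u \<noteq> w \<longrightarrow> (\<forall>z. (w, z) \<in> parcs G \<longrightarrow> gdist G u z \<le> gdist G u w))"
    (is "?L \<longleftrightarrow> ?R")
proof
  assume L: ?L
  then have sub: "X \<subseteq> pverts G" by (simp add: outer_general_position_set_def)
  have "gdist G u z \<le> gdist G u w" if uw: "u \<in> X" "w \<in> X" "u \<noteq> w" and z: "(w, z) \<in> parcs G" for u w z
  proof (rule ccontr)
    assume far: "\<not> gdist G u z \<le> gdist G u w"
    have r: "(u, w) \<in> (parcs G)\<^sup>*" using reach uw sub by blast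
    have dz: "gdist G u z = Suc (gdist G u w)" using gdist_arc_le[OF r z] far by simp
    obtain p where p: "awalk u p w" "length p = gdist G u w"
      using awalk_gdist r uw sub by blast
    \<comment> \<open>As \<open>z\<close> is exactly one step farther from \<open>u\<close> than
      \<open>w\<close> is, the extended walk is again shortest.\<close>
    have "awalk u (p @ [(w, z)]) z"
      using p(1) z by (intro awalk_appendI) (auto simp: awalk_simps dest: wellformed')
    then have sp: "shortest_path G u (p @ [(w, z)]) z"
      using p dz by (simp add: shortest_path_iff)
    \<comment> \<open>With \<open>p\<close> empty, \<open>w\<close> would be the start of the path
      and not an inner vertex.\<close>
    have "p \<noteq> []" using p(1) uw by auto
    then have "w \<in> set (inner_verts (p @ [(w, z)]))" by (auto simp: inner_verts_def)
    with sp uw have "\<not> positionable G X u z" by (auto simp: positionable_def)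
    \<comment> \<open>\<open>z\<close> may lie in \<open>X\<close>, where the definition constrains
      only distinct vertices.\<close>
    moreover have "u \<noteq> z" using dz gdist_le[of u u 0 G] by auto
    ultimately show False
      using L uw wellformed'(2)[OF z] unfolding outer_general_position_set_def by blast
  qed
  with sub show ?R by blast
next
  assume R: ?R
  \<comment> \<open>One argument for arbitrary \<open>v\<close> covers both clauses of the
    definition, \<open>v\<close> inside and outside \<open>X\<close>.\<close>
  have "positionable G X u v" if u: "u \<in> X" for u v
    unfolding positionable_def
  proof
    assume "\<exists>p. shortest_path G u p v \<and> (\<exists>w \<in> set (inner_verts p). w \<in> X)"
    then obtain p w where p: "shortest_path G u p v" and w: "w \<in> set (inner_verts p)" "w \<in> X"
      by blast
    have ap: "apath u p v" using p by (simp add: shortest_path_def)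
    \<comment> \<open>\<open>inner_verts\<close> lists the tails of all arcs but the first.\<close>
    obtain e where e: "e \<in> set (tl p)" "fst e = w"
      using w(1) by (auto simp: inner_verts_def map_tl[symmetric])
    have uw: "u \<noteq> w" using w(1) ap set_inner_verts[OF ap] by auto
    obtain z where e': "(w, z) \<in> set p" using e by (metis list_set_tl prod.collapse)
    then obtain a b where ab: "p = a @ (w, z) # b" by (meson split_list)
    then have aw: "awalk u a w" and wz: "(w, z) \<in> parcs G" and b: "awalk z b v"
      using p by (auto simp: shortest_path_iff awalk_Cons_iff)
    have r: "(u, z) \<in> (parcs G)\<^sup>*" using reach u R wz wellformed' by blast
    \<comment> \<open>\<open>c\<close> replaces the piece of \<open>p\<close> that ends in
      \<open>z\<close>. Maximal distance bounds its length by \<open>length a\<close>, while that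
      piece has \<open>Suc (length a)\<close> arcs, so \<open>c @ b\<close> would be shorter than
      the shortest path \<open>p\<close>.\<close>
    obtain c where c: "awalk u c z" "length c = gdist G u z"
      using awalk_gdist r u R by blast
    have "length p = gdist G u v" using p by (simp add: shortest_path_iff)
    also have "\<dots> \<le> length (c @ b)" using c b by (intro gdist_le_length awalk_appendI)
    also have "\<dots> \<le> gdist G u w + length b" using R u w uw wz c by auto
    also have "\<dots> \<le> length a + length b" using gdist_le_length[OF aw] by simp
    finally show False using ab by simp
  qed
  with R show ?L by (auto simp: outer_general_position_set_def)
qed

end

section \<open>Distances in lexicographic products\<close>

text \<open>The lifted walk keeps the second coordinate \<open>h\<close> until its last arc, which
  switches to \<open>h'\<close>; an arc of \<open>G\<close> joins all vertices of the two layers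
  over its ends. The switch takes an arc, hence \<open>n \<noteq> 0\<close>.\<close>

lemma relpow_lex_product:
  assumes "(g, g') \<in> parcs G ^^ n" "n \<noteq> 0" "pair_wf_digraph G" "h \<in> pverts K" "h' \<in> pverts K"
  shows "((g, h), (g', h')) \<in> parcs (lex_product G K) ^^ n"
proof -
  interpret pair_wf_digraph G by fact
  have arc: "((a, h1), (b, h2)) \<in> parcs (lex_product G K)"
    if "(a, b) \<in> parcs G" "h1 \<in> pverts K" "h2 \<in> pverts K" for a b h1 h2
    using that wellformed' by (auto simp: lex_product_def)
  show ?thesis using assms(1,2,5)
  proof (induction n arbitrary: g' h')
    case (Suc n)
    then obtain x where x: "(g, x) \<in> parcs G ^^ n" "(x, g') \<in> parcs G" by auto
    show ?case
    proof (cases "n = 0")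
      case True
      then show ?thesis using x Suc.prems arc assms(4) by auto
    next
      case False
      then have "((g, h), (x, h)) \<in> parcs (lex_product G K) ^^ n"
        using Suc.IH x assms(4) by blast
      then show ?thesis using arc[OF x(2) assms(4) Suc.prems(3)] by auto
    qed
  qed simp
qed

text \<open>Arcs inside a layer project to standing still, so the projected walk may be
  shorter.\<close>

lemma relpow_fst_lex_product:
  assumes "(x, y) \<in> parcs (lex_product G K) ^^ n"
  shows "\<exists>n' \<le> n. (fst x, fst y) \<in> parcs G ^^ n'"
  using assms
proof (induction n arbitrary: y)
  case (Suc n)
  then obtain z where z: "(x, z) \<in> parcs (lex_product G K) ^^ n" "(z, y) \<in> parcs (lex_product G K)"
    by auto
  then obtain n' where n': "n' \<le> n" "(fst x, fst z) \<in> parcs G ^^ n'" using Suc.IH by blast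
  from z(2) consider "(fst z, fst y) \<in> parcs G" | "fst z = fst y" by (auto simp: lex_product_def)
  then show ?case
  proof cases
    case 1
    then have "(fst x, fst y) \<in> parcs G ^^ Suc n'" using n' by auto
    then show ?thesis using n' by (meson Suc_le_mono)
  next
    case 2
    then show ?thesis using n' by (metis le_SucI)
  qed
qed simp

text \<open>Lifting a walk of \<open>G\<close> gives one inequality, projecting a walk of the
  product the other. Lifting with arbitrary second coordinates requires positive length, which
  \<open>g \<noteq> g'\<close> ensures.\<close>

lemma gdist_lex_product:
  assumes "pair_wf_digraph G" "(g, g') \<in> (parcs G)\<^sup>*" "g \<noteq> g'" "h \<in> pverts K" "h' \<in> pverts K"
  shows "gdist (lex_product G K) (g, h) (g', h') = gdist G g g'"
proof (rule antisym)
  have "gdist G g g' \<noteq> 0" using assms by (simp add: gdist_eq_0_iff)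
  then have w: "((g, h), (g', h')) \<in> parcs (lex_product G K) ^^ gdist G g g'"
    using assms relpow_gdist by (intro relpow_lex_product) auto
  then show "gdist (lex_product G K) (g, h) (g', h') \<le> gdist G g g'" by (rule gdist_le)
  have "((g, h), (g', h')) \<in> parcs (lex_product G K) ^^ gdist (lex_product G K) (g, h) (g', h')"
    using w by (intro relpow_gdist relpow_imp_rtrancl)
  from relpow_fst_lex_product[OF this]
  show "gdist G g g' \<le> gdist (lex_product G K) (g, h) (g', h')"
    by (auto dest!: gdist_le)
qed

lemma gdist_le_1: "u = v \<or> (u, v) \<in> parcs G \<Longrightarrow> gdist G u v \<le> 1"
  by (metis One_nat_def gdist_le le_SucI relpow_0_I relpow_1)

section \<open>Outer general position sets in the product with a complete graph\<close>

locale lex_product_complete = pair_wf_digraph G for G :: "'a pair_pre_digraph" +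
  fixes K :: "'b pair_pre_digraph"
  assumes reach: "\<And>u v. u \<in> pverts G \<Longrightarrow> v \<in> pverts G \<Longrightarrow> (u, v) \<in> (parcs G)\<^sup>*"
    and complete: "parcs K = {(u, v). u \<in> pverts K \<and> v \<in> pverts K \<and> u \<noteq> v}"
begin

lemma pair_wf_digraph_lex_product: "pair_wf_digraph (lex_product G K)"
  by unfold_locales (auto simp: lex_product_def)

lemma reach_lex_product:
  assumes "x \<in> pverts (lex_product G K)" "y \<in> pverts (lex_product G K)"
  shows "(x, y) \<in> (parcs (lex_product G K))\<^sup>*"
proof -
  obtain g h g' h' where xy: "x = (g, h)" "y = (g', h')" "g \<in> pverts G" "g' \<in> pverts G"
    "h \<in> pverts K" "h' \<in> pverts K" using assms by (auto simp: lex_product_def)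
  show ?thesis
  proof (cases "g = g'")
    case True
    then have "x = y \<or> (x, y) \<in> parcs (lex_product G K)"
      using xy by (auto simp: lex_product_def complete)
    then show ?thesis by auto
  next
    case False
    then have "gdist G g g' \<noteq> 0" using reach xy by (simp add: gdist_eq_0_iff)
    moreover have "(g, g') \<in> parcs G ^^ gdist G g g'" using reach xy by (intro relpow_gdist)
    ultimately show ?thesis unfolding xy using xy
      by (intro relpow_imp_rtrancl[OF relpow_lex_product] pair_wf_digraph_axioms)
  qed
qed

lemma gdist_pos:
  assumes "x \<in> pverts (lex_product G K)" "y \<in> pverts (lex_product G K)" "x \<noteq> y"
  shows "1 \<le> gdist (lex_product G K) x y"
  using gdist_eq_0_iff[OF reach_lex_product[OF assms(1,2)]] assms(3) by simp

lemma outer_general_position_set_lex_product_iff: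
  "outer_general_position_set (lex_product G K) Y \<longleftrightarrow>
    Y \<subseteq> pverts (lex_product G K) \<and> outer_general_position_set G (fst ` Y)"
  (is "_ \<longleftrightarrow> ?sub \<and> _")
proof -
  interpret L: pair_wf_digraph "lex_product G K" by (rule pair_wf_digraph_lex_product)
  let ?d = "gdist (lex_product G K)"
  \<comment> \<open>The condition for a single pair. Inside a layer the right side is vacuous, and
    the left side holds because \<open>u\<close> and \<open>w\<close> are adjacent twins.\<close>
  have eq: "(\<forall>z. (w, z) \<in> parcs (lex_product G K) \<longrightarrow> ?d u z \<le> ?d u w) \<longleftrightarrow>
      (fst u \<noteq> fst w \<longrightarrow> (\<forall>z. (fst w, z) \<in> parcs G \<longrightarrow> gdist G (fst u) z \<le> gdist G (fst u) (fst w)))"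
    (is "?A \<longleftrightarrow> ?B")
    if u: "u \<in> pverts (lex_product G K)" and w: "w \<in> pverts (lex_product G K)" and "u \<noteq> w" for u w
  proof -
    obtain g h g' h' where uw: "u = (g, h)" "w = (g', h')" "g \<in> pverts G" "g' \<in> pverts G"
      "h \<in> pverts K" "h' \<in> pverts K" using u w by (auto simp: lex_product_def)
    have pos: "1 \<le> ?d u w" using that by (rule gdist_pos)
    show ?thesis
    proof (intro iffI impI allI)
      fix z assume A: ?A and ne: "fst u \<noteq> fst w" and z: "(fst w, z) \<in> parcs G"
      have zK: "(w, (z, h)) \<in> parcs (lex_product G K)"
        using z uw wellformed' by (auto simp: lex_product_def)
      show "gdist G (fst u) z \<le> gdist G (fst u) (fst w)"
      \<comment> \<open>The two distances are known to agree only across different layers; a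
        neighbour in the layer of \<open>u\<close> has distance 0 in \<open>G\<close>.\<close>
      proof (cases "g = z")
        case True
        then show ?thesis using gdist_le[of g g 0 G] uw by simp
      next
        case False
        then have "?d u (z, h) = gdist G g z"
          using uw z wellformed' by (auto intro!: gdist_lex_product reach pair_wf_digraph_axioms)
        moreover have "?d u w = gdist G g g'"
          using uw ne by (auto intro!: gdist_lex_product reach pair_wf_digraph_axioms)
        ultimately show ?thesis using A zK uw by fastforce
      qed
    next
      fix z assume B: ?B and z: "(w, z) \<in> parcs (lex_product G K)"
      obtain x k where x: "z = (x, k)" "x \<in> pverts G" "k \<in> pverts K"
        "(g', x) \<in> parcs G \<or> g' = x" using z uw by (auto simp: lex_product_def)
      show "?d u z \<le> ?d u w"
      \<comment> \<open>Either equation makes \<open>z\<close> equal or adjacent to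
        \<open>u\<close>, by completeness of \<open>K\<close> if they share a layer, so its distance
        1 at most cannot exceed that of \<open>w\<close>.\<close>
      proof (cases "g = x \<or> g = g'")
        case True
        then have "u = z \<or> (u, z) \<in> parcs (lex_product G K)"
          using uw x complete by (auto simp: lex_product_def)
        then show ?thesis using gdist_le_1[of u z "lex_product G K"] pos by simp
      next
        case False
        then have "?d u z = gdist G g x" "?d u w = gdist G g g'"
          using uw x by (auto intro!: gdist_lex_product reach pair_wf_digraph_axioms)
        then show ?thesis using B False x uw by auto
      qed
    qed
  qed
  have "outer_general_position_set (lex_product G K) Y \<longleftrightarrow> ?sub \<and>
      (\<forall>u \<in> Y. \<forall>w \<in> Y. u \<noteq> w \<longrightarrow> (\<forall>z. (w, z) \<in> parcs (lex_product G K) \<longrightarrow> ?d u z \<le> ?d u w))"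
    by (rule L.outer_general_position_set_iff[OF reach_lex_product])
  also have "\<dots> \<longleftrightarrow> ?sub \<and>
      (\<forall>u \<in> Y. \<forall>w \<in> Y. fst u \<noteq> fst w \<longrightarrow>
        (\<forall>z. (fst w, z) \<in> parcs G \<longrightarrow> gdist G (fst u) z \<le> gdist G (fst u) (fst w)))"
  proof (intro conj_cong refl ball_cong)
    fix u w assume "?sub" "u \<in> Y" "w \<in> Y"
    then have "u \<in> pverts (lex_product G K)" "w \<in> pverts (lex_product G K)" by blast+
    then show "(u \<noteq> w \<longrightarrow> (\<forall>z. (w, z) \<in> parcs (lex_product G K) \<longrightarrow> ?d u z \<le> ?d u w)) \<longleftrightarrow>
      (fst u \<noteq> fst w \<longrightarrow> (\<forall>z. (fst w, z) \<in> parcs G \<longrightarrow> gdist G (fst u) z \<le> gdist G (fst u) (fst w)))"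
      using eq[of u w] by (cases "u = w") simp_all
  qed
  also have "\<dots> \<longleftrightarrow> ?sub \<and> outer_general_position_set G (fst ` Y)"
    by (subst outer_general_position_set_iff[OF reach]) (auto simp: lex_product_def)
  finally show ?thesis .
qed

end

section \<open>Comparing the maxima\<close>

lemma card_le_gp_outer:
  "finite (pverts G) \<Longrightarrow> outer_general_position_set G X \<Longrightarrow> card X \<le> gp_outer G"
  unfolding gp_outer_def by (intro Max_ge) (auto intro: finite_outer_general_position_sets)

lemma gp_outer_attained:
  assumes "finite (pverts G)"
  obtains X where "outer_general_position_set G X" "card X = gp_outer G"
proof -
  have "gp_outer G \<in> card ` {X. outer_general_position_set G X}"
    unfolding gp_outer_def using outer_general_position_set_empty assms
    by (intro Max_in) (auto intro: finite_outer_general_position_sets)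
  then show ?thesis using that by auto
qed

text \<open>Connectivity refers to the symmetric closure of the digraph; for symmetric arcs it
  amounts to strong connectivity, hence to directed reachability.\<close>

lemma (in pair_sym_digraph) connected_rtrancl:
  assumes "Digraph_Component.connected (with_proj G)" "u \<in> pverts G" "v \<in> pverts G"
  shows "(u, v) \<in> (parcs G)\<^sup>*"
proof -
  have "strongly_connected (with_proj G)"
    using assms(1) sym_arcs by (rule symmetric_connected_imp_strongly_connected[rotated])
  then have "reachable (with_proj G) u v" using assms(2,3) by (simp add: strongly_connected_def)
  then show ?thesis using reachable_rtranclI by force
qed

theorem theorem5p6:
  fixes G :: "'a pair_pre_digraph" and K :: "'b pair_pre_digraph" and m :: nat
  assumes "pair_graph G"
    and "Digraph_Component.connected (with_proj G)"
    and "2 \<le> card (pverts G)"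
    and "2 \<le> m"
    and "complete_digraph m (with_proj K)"
  shows "gp_outer (lex_product G K) = m * gp_outer G"
proof -
  interpret G: pair_graph G by fact
  have cardK: "card (pverts K) = m" using assms(5) by (simp add: complete_digraph_pair_def)
  interpret lex_product_complete G K
    using assms(2,5) by unfold_locales (auto simp: G.connected_rtrancl complete_digraph_pair_def)
  have finK: "finite (pverts K)" using assms(5) by (simp add: complete_digraph_pair_def)
  have fin: "finite (pverts (lex_product G K))"
    using finK by (simp add: lex_product_def G.pair_finite_verts)
  show ?thesis
  proof (rule antisym)
    obtain Y where Y: "outer_general_position_set (lex_product G K) Y"
      "card Y = gp_outer (lex_product G K)"
      using gp_outer_attained[OF fin] .
    have Y': "Y \<subseteq> pverts (lex_product G K)" "outer_general_position_set G (fst ` Y)"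
      using Y(1) by (simp_all add: outer_general_position_set_lex_product_iff)
    \<comment> \<open>\<open>Y\<close> is contained in the union of the full layers that it
      meets.\<close>
    have "card Y \<le> card (fst ` Y \<times> pverts K)"
    proof (intro card_mono finite_cartesian_product finite_imageI finK)
      show "finite Y" using Y'(1) fin by (rule finite_subset)
      show "Y \<subseteq> fst ` Y \<times> pverts K" using Y'(1) by (force simp: lex_product_def)
    qed
    also have "\<dots> \<le> gp_outer G * m"
      using card_le_gp_outer[OF G.pair_finite_verts Y'(2)] by (simp add: card_cartesian_product cardK)
    finally show "gp_outer (lex_product G K) \<le> m * gp_outer G"
      using Y(2) by (simp add: mult.commute)
  next
    obtain X where X: "outer_general_position_set G X" "card X = gp_outer G"
      using gp_outer_attained[OF G.pair_finite_verts] .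
    \<comment> \<open>The bound on \<open>m\<close> makes \<open>pverts K\<close> nonempty;
      otherwise the projection would be empty.\<close>
    have "fst ` (X \<times> pverts K) = X" using cardK assms(4) by (auto simp: fst_image_times)
    moreover have "X \<times> pverts K \<subseteq> pverts (lex_product G K)"
      using X(1) by (auto simp: outer_general_position_set_def lex_product_def)
    ultimately have "outer_general_position_set (lex_product G K) (X \<times> pverts K)"
      using X(1) by (simp add: outer_general_position_set_lex_product_iff)
    from card_le_gp_outer[OF fin this]
    show "m * gp_outer G \<le> gp_outer (lex_product G K)"
      by (simp add: card_cartesian_product cardK X(2) mult.commute)
  qed
qed

end
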